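(* Let $\Phi:\mathcal{O}P^2\to\mathbb{O}P^2$ be the map defined on points and lines by $$(x,y)\mapsto(\tau^{2}(\overline{x}),y),\quad (s)\mapsto(\tau(\overline{s})),\quad(\infty)\mapsto(\infty),\quad [s,t]\mapsto[\tau(\overline{s}),t],\quad[c]\mapsto[\tau^{2}(\overline{c})],\quad[\infty]\mapsto[\infty].$$ Then $\Phi$ is an isometry: for all affine points $p_1=(x_1,y_1)$, $p_2=(x_2,y_2)$ of $\mathcal{O}P^2$ one has $d_{\mathbb{O}}(\Phi(p_1),\Phi(p_2))=d_{\mathcal{O}}(p_1,p_2)$.
   Context: The real Okubo algebra $\mathcal{O}$ is the 8-dimensional real vector space of $3\times 3$ complex Hermitian traceless matrices with bilinear product $x*y=\mu\,xy+\overline{\mu}\,yx-\frac13\mathrm{Tr}(xy)\,I$, where $\mu=\frac16(3+\mathrm{i}\sqrt3)$, and norm $n(x)=\frac16\mathrm{Tr}(x^2)$, with polar form $\langle x,y\rangle=n(x+y)-n(x)-n(y)$. The element $e=\mathrm{diag}(2,-1,-1)$ is an idempotent, $e*e=e$, with $n(e)=1$. On the same vector space the product $x\cdot y=(e*x)*(y*e)$ with the same norm $n$ gives a unital (unit $e$) composition division algebra of dimension 8, hence the algebra of octonions $\mathbb{O}$; thus $\mathcal{O}$ and $\mathbb{O}$ share the same underlying vector space and norm. Define the linear maps $\overline{x}=\langle x,e\rangle e-x$ and $\tau(x)=\langle x,e\rangle e-x*e$ on this space. For $(A,\star)=(\mathcal{O},* )$ or $(\mathbb{O},\cdot)$ the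 projective plane over $A$ is described in affine coordinates as follows. Points: affine points $(x,y)\in A^2$; points at infinity $(s)$, $s\in A$; and $(\infty)$. Lines: $[s,t]=\{(x,s\star x+t):x\in A\}\cup\{(s)\}$ for $s,t\in A$; $[c]=(\{c\}\times A)\cup\{(\infty)\}$ for $c\in A$; $[\infty]=\{(s):s\in A\}\cup\{(\infty)\}$. Incidence is membership. $\mathcal{O}P^2$ denotes this plane for $(\mathcal{O},* )$ and $\mathbb{O}P^2$ this plane for $(\mathbb{O},\cdot)$. The distance functions on affine points are, for both planes, $d_{\mathcal{O}}(p_1,p_2)=n(x_1-x_2)^2+n(y_1-y_2)^2$ and $d_{\mathbb{O}}(p_1,p_2)=n(x_1-x_2)^2+n(y_1-y_2)^2$ for $p_i=(x_i,y_i)$. *)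

theory Defs
  imports "HOL-Analysis.Analysis"
begin

definition hermitian :: "complex^3^3 \<Rightarrow> bool" where
  "hermitian A \<longleftrightarrow> (\<forall>i j. cnj (A $ j $ i) = A $ i $ j)"

typedef okubo = "{A :: complex^3^3. hermitian A \<and> trace A = 0}"
  morphisms matrix_of Abs_okubo
  by (rule exI[of _ 0]) (simp add: hermitian_def trace_def)

setup_lifting type_definition_okubo

instantiation okubo :: real_vector
begin

lift_definition zero_okubo :: okubo is 0
  by (simp add: hermitian_def trace_def)

lift_definition plus_okubo :: "okubo \<Rightarrow> okubo \<Rightarrow> okubo" is "(+)"
  by (auto simp: hermitian_def trace_add)

lift_definition minus_okubo :: "okubo \<Rightarrow> okubo \<Rightarrow> okubo" is "(-)"
  by (auto simp: hermitian_def trace_sub)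

lift_definition uminus_okubo :: "okubo \<Rightarrow> okubo" is uminus
  by (auto simp: hermitian_def trace_def sum_negf)

lift_definition scaleR_okubo :: "real \<Rightarrow> okubo \<Rightarrow> okubo" is scaleR
proof -
  fix r :: real and A :: "complex^3^3"
  assume "hermitian A \<and> trace A = 0"
  moreover have "trace (r *\<^sub>R A) = r *\<^sub>R trace A"
    by (simp add: trace_def scaleR_sum_right)
  moreover have "cnj ((r *\<^sub>R A) $ i $ j) = r *\<^sub>R cnj (A $ i $ j)" for i j
    by simp
  ultimately show "hermitian (r *\<^sub>R A) \<and> trace (r *\<^sub>R A) = 0"
    unfolding hermitian_def by (metis scaleR_zero_right vector_scaleR_component)
qed

instance
proof
  fix x y z :: okubo and a b :: real
  show "x + y + z = x + (y + z)" by transfer (rule add.assoc)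
  show "x + y = y + x" by transfer (rule add.commute)
  show "0 + x = x" by transfer (rule add_0)
  show "- x + x = 0" by transfer (rule left_minus)
  show "x - y = x + - y" by transfer (rule diff_conv_add_uminus)
  show "a *\<^sub>R (x + y) = a *\<^sub>R x + a *\<^sub>R y" by transfer (rule scaleR_add_right)
  show "(a + b) *\<^sub>R x = a *\<^sub>R x + b *\<^sub>R x" by transfer (rule scaleR_add_left)
  show "a *\<^sub>R b *\<^sub>R x = (a * b) *\<^sub>R x" by transfer (rule scaleR_scaleR)
  show "1 *\<^sub>R x = x" by transfer (rule scaleR_one)
qed

end

definition mu :: complex where
  "mu = (3 + \<i> * of_real (sqrt 3)) / 6"

definition cscale :: "complex \<Rightarrow> complex^3^3 \<Rightarrow> complex^3^3" where
  "cscale c A = map_matrix (\<lambda>z. c * z) A"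

definition okubo_matrix_mult :: "complex^3^3 \<Rightarrow> complex^3^3 \<Rightarrow> complex^3^3" where
  "okubo_matrix_mult X Y =
     cscale mu (X ** Y) + cscale (cnj mu) (Y ** X) - cscale (trace (X ** Y) / 3) (mat 1)"

lemma mu_plus_cnj: "mu + cnj mu = 1"
  by (simp add: mu_def complex_eq_iff)

lemma trace_cscale: "trace (cscale c A) = c * trace A"
  by (simp add: trace_def cscale_def map_matrix_def sum_distrib_left)

lemma hermitian_trace_mult_real:
  assumes "hermitian X" and "hermitian Y"
  shows "cnj (trace (X ** Y)) = trace (X ** Y)"
proof -
  have X: "cnj (X $ i $ j) = X $ j $ i" and Y: "cnj (Y $ i $ j) = Y $ j $ i" for i j
    using assms by (simp_all add: hermitian_def)
  have "cnj (trace (X ** Y)) = trace (Y ** X)"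
    by (simp add: trace_def matrix_matrix_mult_def X Y mult.commute)
  then show ?thesis
    by (simp only: trace_mul_sym[of Y X])
qed

lemma okubo_matrix_mult_closed:
  assumes "hermitian X" and "hermitian Y"
  shows "hermitian (okubo_matrix_mult X Y)" and "trace (okubo_matrix_mult X Y) = 0"
proof -
  have X: "cnj (X $ i $ j) = X $ j $ i" and Y: "cnj (Y $ i $ j) = Y $ j $ i" for i j
    using assms by (simp_all add: hermitian_def)
  have XY: "cnj ((X ** Y) $ i $ j) = (Y ** X) $ j $ i"
    and YX: "cnj ((Y ** X) $ i $ j) = (X ** Y) $ j $ i" for i j
    by (simp_all add: matrix_matrix_mult_def X Y mult.commute)
  show "hermitian (okubo_matrix_mult X Y)"
    by (simp add: hermitian_def okubo_matrix_mult_def cscale_def map_matrix_def XY YX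
        hermitian_trace_mult_real[OF assms] mat_def)
  have "trace (okubo_matrix_mult X Y) = (mu + cnj mu) * trace (X ** Y) - trace (X ** Y)"
    by (simp add: okubo_matrix_mult_def trace_add trace_sub trace_cscale trace_I
        trace_mul_sym[of Y X] distrib_right)
  then show "trace (okubo_matrix_mult X Y) = 0"
    by (simp add: mu_plus_cnj)
qed

lift_definition okubo_mult :: "okubo \<Rightarrow> okubo \<Rightarrow> okubo" (infixl "\<star>" 70) is okubo_matrix_mult
  by (auto intro: okubo_matrix_mult_closed)

text \<open>The trace of the square of a Hermitian matrix is real (lemma \<open>of_real_norm_n\<close> below), so
  taking the real part only changes the type.\<close>

definition norm_n :: "okubo \<Rightarrow> real" where
  "norm_n x = Re (trace (matrix_of x ** matrix_of x)) / 6"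

lemma of_real_norm_n: "complex_of_real (norm_n x) = trace (matrix_of x ** matrix_of x) / 6"
proof -
  have "hermitian (matrix_of x)"
    using matrix_of[of x] by simp
  from hermitian_trace_mult_real[OF this this] show ?thesis
    by (simp add: norm_n_def complex_eq_iff)
qed

definition polar_n :: "okubo \<Rightarrow> okubo \<Rightarrow> real" where
  "polar_n x y = norm_n (x + y) - norm_n x - norm_n y"

lift_definition okubo_e :: okubo is
  "\<chi> i j. if i = j then (if i = 1 then 2 else - 1) else 0"
  by (simp add: hermitian_def trace_def sum_3)

lemma norm_n_okubo_e: "norm_n okubo_e = 1"
  by (simp add: norm_n_def okubo_e.rep_eq trace_def matrix_matrix_mult_def sum_3)

lemma okubo_e_idem: "okubo_e \<star> okubo_e = okubo_e"
proof -
  have mu: "mu * 4 + cnj mu * 4 = 4"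
    using mu_plus_cnj by algebra
  show ?thesis
    by transfer (simp add: okubo_matrix_mult_def cscale_def map_matrix_def vec_eq_iff forall_3
        matrix_matrix_mult_def sum_3 trace_def mat_def mu mu_plus_cnj)
qed

text \<open>The octonions live on the same vector space and carry the same norm \<open>norm_n\<close>.\<close>

definition oct_mult :: "okubo \<Rightarrow> okubo \<Rightarrow> okubo" where
  "oct_mult x y = (okubo_e \<star> x) \<star> (y \<star> okubo_e)"

definition okubo_conj :: "okubo \<Rightarrow> okubo" where
  "okubo_conj x = polar_n x okubo_e *\<^sub>R okubo_e - x"

definition tau :: "okubo \<Rightarrow> okubo" where
  "tau x = polar_n x okubo_e *\<^sub>R okubo_e - x \<star> okubo_e"

datatype 'a plane_point =
    Affine 'a 'a
  | Slope 'a
  | Infty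

datatype 'a plane_line =
    Sloped 'a 'a
  | Vertical 'a
  | Line_at_infinity

text \<open>Lines are represented by their coordinates; lemma \<open>inj_points_on\<close> shows that for both products
  a line is determined by its set of points. The points of the two planes are the same, and only
  the incidence relation depends on the product.\<close>

fun points_on :: "('a \<Rightarrow> 'a \<Rightarrow> 'a) \<Rightarrow> 'a::real_vector plane_line \<Rightarrow> 'a plane_point set" where
  "points_on m (Sloped s t) = {Affine x (m s x + t) | x. True} \<union> {Slope s}"
| "points_on m (Vertical c) = {Affine c y | y. True} \<union> {Infty}"
| "points_on m Line_at_infinity = {Slope s | s. True} \<union> {Infty}"

definition okubo_incident :: "okubo plane_point \<Rightarrow> okubo plane_line \<Rightarrow> bool" where
  "okubo_incident p l \<longleftrightarrow> p \<in> points_on okubo_mult l"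

definition oct_incident :: "okubo plane_point \<Rightarrow> okubo plane_line \<Rightarrow> bool" where
  "oct_incident p l \<longleftrightarrow> p \<in> points_on oct_mult l"

lemma inj_points_on: "inj (points_on okubo_mult)" "inj (points_on oct_mult)"
proof -
  have inj: "inj (points_on m)" if m: "\<And>s. m s 0 = 0" for m :: "okubo \<Rightarrow> okubo \<Rightarrow> okubo"
  proof (rule injI)
    fix k l
    assume eq: "points_on m k = points_on m l"
    then have *: "p \<in> points_on m k \<longleftrightarrow> p \<in> points_on m l" for p
      by simp
    show "k = l"
    proof (cases k)
      case (Sloped s t)
      with *[of Infty] obtain s' t' where l: "l = Sloped s' t'"
        by (cases l) simp_all
      show ?thesis
        using *[of "Slope s"] *[of "Affine 0 t"] by (simp add: Sloped l m)
    next
      case (Vertical c)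
      with *[of Infty] *[of "Slope 0"] obtain c' where l: "l = Vertical c'"
        by (cases l) simp_all
      show ?thesis
        using *[of "Affine c 0"] by (simp add: Vertical l)
    next
      case Line_at_infinity
      with *[of Infty] *[of "Slope 0"] show ?thesis
        by (cases l) simp_all
    qed
  qed
  have right0: "x \<star> 0 = 0" for x
    by transfer (simp add: okubo_matrix_mult_def cscale_def map_matrix_def vec_eq_iff
        matrix_matrix_mult_def trace_def)
  have left0: "0 \<star> x = 0" for x
    by transfer (simp add: okubo_matrix_mult_def cscale_def map_matrix_def vec_eq_iff
        matrix_matrix_mult_def trace_def)
  show "inj (points_on okubo_mult)"
    by (rule inj) (rule right0)
  show "inj (points_on oct_mult)"
    by (rule inj) (simp add: oct_mult_def left0 right0)
qed

definition affine_points :: "'a plane_point set" where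
  "affine_points = {Affine x y | x y. True}"

fun okubo_dist :: "okubo plane_point \<Rightarrow> okubo plane_point \<Rightarrow> real" where
  "okubo_dist (Affine x1 y1) (Affine x2 y2) = (norm_n (x1 - x2))\<^sup>2 + (norm_n (y1 - y2))\<^sup>2"
| "okubo_dist _ _ = undefined"

fun oct_dist :: "okubo plane_point \<Rightarrow> okubo plane_point \<Rightarrow> real" where
  "oct_dist (Affine x1 y1) (Affine x2 y2) = (norm_n (x1 - x2))\<^sup>2 + (norm_n (y1 - y2))\<^sup>2"
| "oct_dist _ _ = undefined"

fun Phi_point :: "okubo plane_point \<Rightarrow> okubo plane_point" where
  "Phi_point (Affine x y) = Affine ((tau ^^ 2) (okubo_conj x)) y"
| "Phi_point (Slope s) = Slope (tau (okubo_conj s))"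
| "Phi_point Infty = Infty"

fun Phi_line :: "okubo plane_line \<Rightarrow> okubo plane_line" where
  "Phi_line (Sloped s t) = Sloped (tau (okubo_conj s)) t"
| "Phi_line (Vertical c) = Vertical ((tau ^^ 2) (okubo_conj c))"
| "Phi_line Line_at_infinity = Line_at_infinity"

end

theory Submission
  imports Defs
begin

text \<open>
  Since \<^term>\<open>Phi_point\<close> leaves the second coordinate alone, the claim is that \<open>\<tau>\<^sup>2\<close> after conjugation
  is a linear isometry of the norm. Both maps are built from two linear isometries.

  \<^item> Conjugation is minus the reflection in the hyperplane orthogonal to \<open>e\<close>, because \<open>n e = 1\<close>
    (\<open>norm_n_okubo_conj\<close>).

  \<^item> Right multiplication by \<open>e\<close> multiplies the off-diagonal entries of a matrix by complex numbers
    of modulus 1 and permutes the diagonal ones (\<open>matrix_of_mult_e\<close>), while \<open>n\<close> is one sixth of the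
    sum of the squared moduli of the entries (\<open>norm_n_eq_inner\<close>); so it preserves \<open>n\<close>. This is the
    composition law \<open>n (x \<star> y) = n x * n y\<close> for \<open>y = e\<close>.

  The linear isometry \<open>x \<mapsto> x \<star> e\<close> fixes \<open>e\<close>, so it preserves the polar form with \<open>e\<close>.
  Hence \<open>\<tau> x\<close> is the conjugate of \<open>x \<star> e\<close> (\<open>tau_eq_okubo_conj\<close>), and \<open>\<tau>\<close> is a linear isometry too.
\<close>

text \<open>For a Hermitian matrix \<open>X\<close>, the trace of \<open>X\<^sup>2\<close> is the sum of \<open>\<bar>X\<^sub>i\<^sub>j\<bar>\<^sup>2\<close> over all entries.\<close>

lemma norm_n_eq_inner: "norm_n x = (matrix_of x \<bullet> matrix_of x) / 6"
proof -
  have "cnj (matrix_of x $ i $ j) = matrix_of x $ j $ i" for i j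
    using matrix_of[of x] by (simp add: hermitian_def)
  then have "Re (matrix_of x $ i $ j * matrix_of x $ j $ i)
      = matrix_of x $ i $ j \<bullet> matrix_of x $ i $ j" for i j
    by (metis complex_norm_square Re_complex_of_real power2_norm_eq_inner)
  then show ?thesis
    by (simp add: norm_n_def trace_def matrix_matrix_mult_def inner_vec_def)
qed

lemma polar_n_eq_inner: "polar_n x y = (matrix_of x \<bullet> matrix_of y) / 3"
  by (simp add: polar_n_def norm_n_eq_inner plus_okubo.rep_eq inner_add_left inner_add_right
      inner_commute field_simps)

lemma polar_n_diff_left: "polar_n (x - y) z = polar_n x z - polar_n y z"
  by (simp add: polar_n_eq_inner minus_okubo.rep_eq inner_diff_left diff_divide_distrib)

lemma norm_n_scaleR_diff:
  "norm_n (a *\<^sub>R u - x) = a\<^sup>2 * norm_n u - a * polar_n x u + norm_n x"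
  by (simp add: norm_n_eq_inner polar_n_eq_inner minus_okubo.rep_eq scaleR_okubo.rep_eq
      inner_diff_left inner_diff_right inner_commute field_simps power2_eq_square)

lemma norm_n_okubo_conj: "norm_n (okubo_conj x) = norm_n x"
  by (simp add: okubo_conj_def norm_n_scaleR_diff norm_n_okubo_e power2_eq_square)

lemma okubo_conj_diff: "okubo_conj (x - y) = okubo_conj x - okubo_conj y"
  by (simp add: okubo_conj_def polar_n_diff_left algebra_simps)

lemma okubo_mult_add_left: "(x + y) \<star> z = x \<star> z + y \<star> z"
  by transfer (simp add: okubo_matrix_mult_def cscale_def map_matrix_def vec_eq_iff
      matrix_matrix_mult_def trace_def sum.distrib algebra_simps add_divide_distrib)

lemma okubo_mult_diff_left: "(x - y) \<star> z = x \<star> z - y \<star> z"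
  by (metis okubo_mult_add_left add_diff_cancel_right' diff_add_cancel)

text \<open>The factors \<open>3 cnj \<mu> - 1\<close> and \<open>3 \<mu> - 1\<close>, that is \<open>(1 \<mp> \<i>\<surd>3) / 2\<close>, are \<open>\<mu> e\<^sub>j + (cnj \<mu>) e\<^sub>i\<close> for
  \<open>{e\<^sub>i, e\<^sub>j} = {2, -1}\<close>, simplified by \<open>\<mu> + cnj \<mu> = 1\<close>. As \<open>X\<close> is traceless,
  the trace of \<open>X e\<close> is \<open>3 X\<^sub>1\<^sub>1\<close>, and the two lower diagonal entries \<open>- X\<^sub>2\<^sub>2 - X\<^sub>1\<^sub>1\<close> and
  \<open>- X\<^sub>3\<^sub>3 - X\<^sub>1\<^sub>1\<close> are \<open>X\<^sub>3\<^sub>3\<close> and \<open>X\<^sub>2\<^sub>2\<close>.\<close>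

lemma matrix_of_mult_e:
  fixes x :: okubo
  defines "X \<equiv> matrix_of x" and "Z \<equiv> matrix_of (x \<star> okubo_e)"
  shows "Z $ 1 $ 1 = X $ 1 $ 1" "Z $ 2 $ 2 = X $ 3 $ 3" "Z $ 3 $ 3 = X $ 2 $ 2"
    and "Z $ 1 $ 2 = (3 * cnj mu - 1) * X $ 1 $ 2" "Z $ 1 $ 3 = (3 * cnj mu - 1) * X $ 1 $ 3"
    and "Z $ 2 $ 1 = (3 * mu - 1) * X $ 2 $ 1" "Z $ 3 $ 1 = (3 * mu - 1) * X $ 3 $ 1"
    and "Z $ 2 $ 3 = - (X $ 2 $ 3)" "Z $ 3 $ 2 = - (X $ 3 $ 2)"
proof -
  have "trace X = 0"
    using matrix_of[of x] by (simp add: X_def)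
  then have X33: "X $ 3 $ 3 = - X $ 1 $ 1 - X $ 2 $ 2"
    by (simp add: trace_def sum_3 eq_neg_iff_add_eq_0 algebra_simps)
  have cnj_mu: "cnj mu = 1 - mu"
    using mu_plus_cnj by (simp add: algebra_simps)
  have Z: "Z = okubo_matrix_mult X (\<chi> i j. if i = j then (if i = 1 then 2 else - 1) else 0)"
    by (simp add: Z_def X_def okubo_mult.rep_eq okubo_e.rep_eq)
  note entries = Z okubo_matrix_mult_def cscale_def map_matrix_def matrix_matrix_mult_def sum_3
    trace_def mat_def X33 cnj_mu
  show "Z $ 1 $ 1 = X $ 1 $ 1" "Z $ 2 $ 2 = X $ 3 $ 3" "Z $ 3 $ 3 = X $ 2 $ 2"
    and "Z $ 1 $ 2 = (3 * cnj mu - 1) * X $ 1 $ 2" "Z $ 1 $ 3 = (3 * cnj mu - 1) * X $ 1 $ 3"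
    and "Z $ 2 $ 1 = (3 * mu - 1) * X $ 2 $ 1" "Z $ 3 $ 1 = (3 * mu - 1) * X $ 3 $ 1"
    and "Z $ 2 $ 3 = - (X $ 2 $ 3)" "Z $ 3 $ 2 = - (X $ 3 $ 2)"
    by (simp_all add: entries algebra_simps)
qed

lemma norm_n_mult_e: "norm_n (x \<star> okubo_e) = norm_n x"
proof -
  have mu: "cmod (3 * mu - 1) = 1"
    by (simp add: mu_def cmod_def power2_eq_square field_simps)
  then have cnj_mu: "cmod (3 * cnj mu - 1) = 1"
    using complex_mod_cnj[of "3 * mu - 1"] by simp
  have "z \<bullet> z = (cmod z)\<^sup>2" for z :: complex
    by (simp add: power2_norm_eq_inner)
  then show ?thesis
    by (simp add: norm_n_eq_inner inner_vec_def sum_3 matrix_of_mult_e norm_mult mu cnj_mu)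
qed

lemma polar_n_mult_e: "polar_n (x \<star> okubo_e) okubo_e = polar_n x okubo_e"
proof -
  have "x \<star> okubo_e + okubo_e = (x + okubo_e) \<star> okubo_e"
    by (simp add: okubo_mult_add_left okubo_e_idem)
  then show ?thesis
    by (simp add: polar_n_def norm_n_mult_e)
qed

lemma tau_eq_okubo_conj: "tau x = okubo_conj (x \<star> okubo_e)"
  by (simp add: tau_def okubo_conj_def polar_n_mult_e)

lemma norm_n_tau: "norm_n (tau x) = norm_n x"
  by (simp add: tau_eq_okubo_conj norm_n_okubo_conj norm_n_mult_e)

lemma tau_diff: "tau (x - y) = tau x - tau y"
  by (simp add: tau_eq_okubo_conj okubo_mult_diff_left okubo_conj_diff)

lemma norm_n_tau_tau_conj_diff:
  "norm_n ((tau ^^ 2) (okubo_conj x) - (tau ^^ 2) (okubo_conj y)) = norm_n (x - y)"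
  by (simp add: numeral_2_eq_2 norm_n_tau norm_n_okubo_conj
      flip: tau_diff okubo_conj_diff)

theorem theorem25:
  fixes p1 p2 :: "okubo plane_point"
  assumes "p1 \<in> affine_points" and "p2 \<in> affine_points"
  shows "oct_dist (Phi_point p1) (Phi_point p2) = okubo_dist p1 p2"
  using assms by (auto simp: affine_points_def norm_n_tau_tau_conj_diff)

end
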